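(* Let $r\ge 2$ and $k\ge 1$ be integers. Then \[ \sum_{n_1,\ldots,n_r\le x} \tau_{1,k}((n_1,\ldots,n_r))= \zeta(kr)x^r + O(R_{r,k}(x)), \] where $R_{r,k}(x)=x^{r-1}$ if $rk>2$, and $R_{2,1}(x)= x\log x$.
   Context: For an integer $k\ge1$, $\tau_{1,k}(n)$ denotes the number of pairs $(a,b)$ of positive integers with $ab^k=n$. $(n_1,\ldots,n_r)$ denotes the greatest common divisor and $\zeta$ the Riemann zeta function. *)

theory Defs
  imports Complex_Main "HOL-Library.FuncSet" "HOL-Library.Landau_Symbols"
begin

definition tau :: "nat \<Rightarrow> nat \<Rightarrow> nat" where
  "tau k n = card {(a, b). a > 0 \<and> b > 0 \<and> a * b ^ k = n}"

text \<open>
  The Riemann zeta function on the real half-line \<open>s > 1\<close>, given by its Dirichlet series.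
  There is no analytic continuation here: for \<open>s \<le> 1\<close> the series diverges and the value
  is meaningless.
\<close>
definition zeta :: "real \<Rightarrow> real" where
  "zeta s = (\<Sum>m. 1 / real (Suc m) powr s)"

text \<open>
  For \<open>r \<ge> 2\<close> and \<open>k \<ge> 1\<close> the second case occurs exactly when \<open>r = 2\<close> and \<open>k = 1\<close>.
\<close>
definition R :: "nat \<Rightarrow> nat \<Rightarrow> real \<Rightarrow> real" where
  "R r k x = (if r * k > 2 then x ^ (r - 1) else x * ln x)"

end

theory Submission
  imports Defs "HOL-Analysis.Harmonic_Numbers"
begin

text \<open>
  Since \<open>\<tau>\<^sub>1\<^sub>,\<^sub>k(n)\<close> counts the \<open>b\<close> with \<open>b\<^sup>k\<close> dividing \<open>n\<close>, interchanging summations turns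
  the sum into \<open>\<Sum>\<^sub>b \<lfloor>x / b\<^sup>k\<rfloor>\<^sup>r\<close> over \<open>1 \<le> b \<le> x\<close>. Dropping the floors costs at most
  \<open>r x\<^sup>r\<^sup>-\<^sup>1 \<Sum>\<^sub>b 1/b^(k(r - 1))\<close>, which is \<open>O(x\<^sup>r\<^sup>-\<^sup>1)\<close> unless \<open>k(r - 1) = 1\<close>, where
  the harmonic sum produces the logarithm. Completing the series to \<open>\<zeta>(kr)\<close> costs
  \<open>O(x\<^sup>r\<^sup>-\<^sup>1)\<close>, as \<open>\<Sum>\<^sub>b b\<^sup>-\<^sup>2\<close> over \<open>b > N\<close> is at most \<open>1/N\<close>. Letting \<open>b\<close> run up to \<open>x\<close> rather than
  only while \<open>b\<^sup>k \<le> x\<close> is harmless, the extra terms being zero, and keeps this tail small.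
\<close>

text \<open>In a pair \<open>(a, b)\<close> the first entry is determined as
  \<open>n div b ^ k\<close>, so projecting to \<open>b\<close> is a bijection.\<close>

lemma tau_eq_card_dvd:
  assumes "n > 0"
  shows "tau k n = card {b. b > 0 \<and> b ^ k dvd n}"
proof -
  have "bij_betw snd {(a, b). a > 0 \<and> b > 0 \<and> a * b ^ k = n} {b. b > 0 \<and> b ^ k dvd n}"
    by (rule bij_betw_byWitness[where f' = "\<lambda>b. (n div b ^ k, b)"]) (use assms in \<open>auto elim!: dvdE\<close>)
  then show ?thesis
    unfolding tau_def by (rule bij_betw_same_card)
qed

lemma card_multiples:
  fixes d N :: nat
  assumes "d > 0"
  shows "card {m \<in> {1..N}. d dvd m} = N div d"
proof -
  have "{m \<in> {1..N}. d dvd m} = (\<lambda>q. d * q) ` {1..N div d}"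
  proof (intro set_eqI iffI)
    fix m assume "m \<in> {m \<in> {1..N}. d dvd m}"
    then show "m \<in> (\<lambda>q. d * q) ` {1..N div d}"
      using assms by (auto elim!: dvdE simp: less_eq_div_iff_mult_less_eq mult.commute)
  next
    fix m assume "m \<in> (\<lambda>q. d * q) ` {1..N div d}"
    then show "m \<in> {m \<in> {1..N}. d dvd m}"
      using assms by (auto simp: less_eq_div_iff_mult_less_eq mult.commute Suc_le_eq)
  qed
  moreover have "inj_on (\<lambda>q. d * q) {1..N div d}"
    using assms by (auto intro: inj_onI)
  ultimately show ?thesis
    by (simp add: card_image)
qed

text \<open>Double counting of the pairs \<open>(n, b)\<close> such that \<open>b ^ k\<close>
  divides every \<open>n i\<close>: for fixed \<open>b\<close> the admissible tuples form a product
  of \<open>r\<close> copies of the multiples of \<open>b ^ k\<close> up to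
  \<open>N\<close>.\<close>

lemma sum_tau_Gcd:
  fixes r k N :: nat
  assumes "r > 0" and "k > 0"
  shows "(\<Sum>n \<in> {..<r} \<rightarrow>\<^sub>E {1..N}. tau k (GCD i\<in>{..<r}. n i)) = (\<Sum>b=1..N. (N div b ^ k) ^ r)"
proof -
  let ?P = "{..<r} \<rightarrow>\<^sub>E {1..N}"
  have fin: "finite ?P"
    by (intro finite_PiE) auto
  have tau: "tau k (GCD i\<in>{..<r}. n i) = card {b \<in> {1..N}. \<forall>i<r. b ^ k dvd n i}"
    if n: "n \<in> ?P" for n
  proof -
    have n0: "n 0 > 0" "n 0 \<le> N"
      using PiE_mem[OF n, of 0] assms by auto
    have "(GCD i\<in>{..<r}. n i) dvd n 0"
      using assms by (intro Gcd_dvd) auto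
    then have "(GCD i\<in>{..<r}. n i) > 0"
      using n0 by (auto intro: dvd_pos_nat)
    \<comment> \<open>Since \<open>b <= b ^ k <= n 0 <= N\<close>, one finite range for
      \<open>b\<close> serves all tuples, as the interchange of sums requires.\<close>
    moreover have "b \<le> N" if "b > 0" "b ^ k dvd n 0" for b
      using dvd_imp_le[OF that(2) n0(1)] n0(2) self_le_power[of b k] that assms by linarith
    then have "{b. b > 0 \<and> b ^ k dvd (GCD i\<in>{..<r}. n i)} = {b \<in> {1..N}. \<forall>i<r. b ^ k dvd n i}"
      using assms by (auto simp: dvd_Gcd_iff)
    ultimately show ?thesis
      by (simp add: tau_eq_card_dvd)
  qed
  have "(\<Sum>n\<in>?P. tau k (GCD i\<in>{..<r}. n i)) = (\<Sum>n\<in>?P. card {b \<in> {1..N}. \<forall>i<r. b ^ k dvd n i})"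
    by (intro sum.cong refl tau)
  also have "\<dots> = (\<Sum>b=1..N. card {n \<in> ?P. \<forall>i<r. b ^ k dvd n i})"
    by (rule sum_multicount_gen[OF fin]) auto
  also have "\<dots> = (\<Sum>b=1..N. (N div b ^ k) ^ r)"
  proof (rule sum.cong[OF refl])
    fix b assume "b \<in> {1..N}"
    have "{n \<in> ?P. \<forall>i<r. b ^ k dvd n i} = {..<r} \<rightarrow>\<^sub>E {m \<in> {1..N}. b ^ k dvd m}"
      unfolding set_eq_iff mem_Collect_eq PiE_iff lessThan_iff by blast
    then show "card {n \<in> ?P. \<forall>i<r. b ^ k dvd n i} = (N div b ^ k) ^ r"
      using \<open>b \<in> {1..N}\<close> card_multiples[of "b ^ k" N] by (simp add: card_PiE)
  qed
  finally show ?thesis .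
qed

text \<open>Factor out \<open>y - z\<close>, which is at most 1; each of the \<open>r\<close> terms
  of the cofactor is at most \<open>y ^ (r - 1)\<close>.\<close>

lemma power_diff_le:
  fixes y z :: real
  assumes "0 \<le> z" "z \<le> y" "y \<le> z + 1"
  shows "y ^ r - z ^ r \<le> real r * y ^ (r - 1)"
proof (cases r)
  case (Suc s)
  have "(\<Sum>i<Suc s. y ^ i * z ^ (s - i)) \<le> (\<Sum>i<Suc s. y ^ s)"
  proof (rule sum_mono)
    fix i assume "i \<in> {..<Suc s}"
    then have "y ^ s = y ^ i * y ^ (s - i)"
      by (simp flip: power_add)
    then show "y ^ i * z ^ (s - i) \<le> y ^ s"
      using assms by (auto intro!: mult_left_mono power_mono)
  qed
  then have "(\<Sum>i<Suc s. y ^ i * z ^ (s - i)) \<le> real r * y ^ s"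
    by (simp add: Suc del: sum.lessThan_Suc)
  moreover have "y ^ r - z ^ r = (y - z) * (\<Sum>i<Suc s. y ^ i * z ^ (s - i))"
    unfolding Suc by (subst power_diff_sumr2) (simp add: mult.commute)
  moreover have "(y - z) * (\<Sum>i<Suc s. y ^ i * z ^ (s - i)) \<le> 1 * (\<Sum>i<Suc s. y ^ i * z ^ (s - i))"
    using assms by (intro mult_right_mono sum_nonneg) auto
  ultimately show ?thesis
    by (simp add: Suc)
qed simp

text \<open>Taking the floor of \<open>x\<close> before dividing by \<open>d\<close> does not change
  the floor of the quotient, so \<open>power_diff_le\<close> applies to \<open>x / real d\<close>
  and its floor.\<close>

lemma floor_power_error:
  fixes x :: real
  assumes "x \<ge> 0" "d > 0"
  shows "(x / real d) ^ r - real (nat \<lfloor>x\<rfloor> div d) ^ r \<in> {0..real r * (x / real d) ^ (r - 1)}"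
proof -
  have "int (nat \<lfloor>x\<rfloor> div d) = \<lfloor>x / real d\<rfloor>"
    using assms floor_divide_real_eq_div[of "int d" x] by (simp add: zdiv_int)
  then have "real (nat \<lfloor>x\<rfloor> div d) = of_int \<lfloor>x / real d\<rfloor>"
    by (metis of_int_of_nat_eq)
  then have "real (nat \<lfloor>x\<rfloor> div d) \<le> x / real d" "x / real d \<le> real (nat \<lfloor>x\<rfloor> div d) + 1"
    by linarith+
  then show ?thesis
    using power_diff_le[of "real (nat \<lfloor>x\<rfloor> div d)" "x / real d" r]
    by (auto intro: power_mono)
qed

text \<open>Comparison with the telescoping series of \<open>1 / (m + N) - 1 / (m + N + 1)\<close>,
  whose sum is \<open>1 / N\<close>.\<close>

lemma inverse_power_tail:
  fixes N s :: nat
  assumes "N > 0" "s \<ge> 2"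
  shows "summable (\<lambda>m. 1 / real (m + N + 1) ^ s)"
    and "(\<Sum>m. 1 / real (m + N + 1) ^ s) \<in> {0..1 / real N}"
proof -
  have le: "1 / real (m + N + 1) ^ s \<le> 1 / real (m + N) - 1 / real (Suc m + N)" for m
  proof -
    have "real (m + N) * real (m + N + 1) \<le> real (m + N + 1) ^ 2"
      by (simp add: power2_eq_square)
    also have "\<dots> \<le> real (m + N + 1) ^ s"
      using assms by (intro power_increasing) auto
    finally have "1 / real (m + N + 1) ^ s \<le> 1 / (real (m + N) * real (m + N + 1))"
      using assms by (intro divide_left_mono) auto
    also have "\<dots> = 1 / real (m + N) - 1 / real (Suc m + N)"
      using assms by (simp add: field_simps)
    finally show ?thesis .
  qed
  have "(\<lambda>m. 1 / real (m + N)) \<longlonglongrightarrow> 0"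
    using LIMSEQ_ignore_initial_segment[OF lim_1_over_n, of N] by simp
  from telescope_sums'[OF this]
  have sums: "(\<lambda>m. 1 / real (m + N) - 1 / real (Suc m + N)) sums (1 / real N)"
    by simp
  show summ: "summable (\<lambda>m. 1 / real (m + N + 1) ^ s)"
    by (rule summable_comparison_test'[OF sums_summable[OF sums], of 0]) (use le in auto)
  show "(\<Sum>m. 1 / real (m + N + 1) ^ s) \<in> {0..1 / real N}"
    using suminf_le[OF le summ sums_summable[OF sums]] sums_unique[OF sums] suminf_nonneg[OF summ]
    by auto
qed

lemma zeta_split:
  fixes N s :: nat
  assumes "N > 0" "s \<ge> 2"
  shows "zeta (real s) - (\<Sum>b=1..N. 1 / real b ^ s) \<in> {0..1 / real N}"
proof -
  let ?f = "\<lambda>m. 1 / real (Suc m) ^ s"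
  have "summable (\<lambda>m. ?f (m + N))"
    using inverse_power_tail(1)[OF assms] by simp
  then have "summable ?f"
    by (rule summable_iff_shift[THEN iffD1])
  then have "suminf ?f = (\<Sum>m. ?f (m + N)) + (\<Sum>m<N. ?f m)"
    by (rule suminf_split_initial_segment)
  moreover have "(\<Sum>m<N. ?f m) = (\<Sum>b=1..N. 1 / real b ^ s)"
    by (rule sum.reindex_bij_witness[of _ "\<lambda>b. b - 1" Suc]) auto
  moreover have "zeta (real s) = suminf ?f"
    unfolding zeta_def by (simp add: powr_realpow del: of_nat_Suc)
  ultimately show ?thesis
    using inverse_power_tail(2)[OF assms] by simp
qed

text \<open>The partial sums stay below \<open>zeta (real s)\<close>, and splitting off only the
  first term bounds that value by 1 + 1.\<close>

lemma sum_inverse_power_le: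
  fixes N s :: nat
  assumes "N > 0" "s \<ge> 2"
  shows "(\<Sum>b=1..N. 1 / real b ^ s) \<le> 2"
  using zeta_split[OF assms] zeta_split[of 1 s] assms(2) by simp

text \<open>The sequence \<open>harm n - ln n\<close> decreases from its value 1 at
  \<open>n = 1\<close>.\<close>

lemma sum_inverse_le_ln:
  assumes "x \<ge> 1"
  shows "(\<Sum>b=1..nat \<lfloor>x\<rfloor>. 1 / real b) \<le> 1 + ln x"
proof -
  let ?N = "nat \<lfloor>x\<rfloor>"
  have N: "?N \<ge> 1" "real ?N \<le> x"
    using assms by (auto simp: le_nat_iff)
  have "harm ?N - ln (real ?N) \<le> (harm 1 :: real) - ln (real 1)"
    using N by (intro euler_mascheroni_sequence_decreasing) auto
  moreover have "ln (real ?N) \<le> ln x"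
    using N assms by simp
  ultimately show ?thesis
    by (simp add: harm_def inverse_eq_divide)
qed

text \<open>The error consists of the loss from the floors and the tail of the zeta series. The sum
  over \<open>b\<close> in the bound is left unevaluated because its growth separates the two cases
  of \<open>R\<close>.\<close>

lemma sum_floor_power_error:
  fixes x :: real and r k :: nat
  assumes "r \<ge> 2" "k \<ge> 1" "x \<ge> 1"
  defines "N \<equiv> nat \<lfloor>x\<rfloor>"
  shows "\<bar>(\<Sum>b=1..N. real (N div b ^ k) ^ r) - zeta (real (k * r)) * x ^ r\<bar>
           \<le> x ^ (r - 1) * (2 + real r * (\<Sum>b=1..N. 1 / real b ^ (k * (r - 1))))"
proof -
  let ?A = "\<Sum>b=1..N. 1 / real b ^ (k * r)"
  have "N > 0"
    using assms by (simp add: N_def)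
  \<comment> \<open>This turns the tail contribution \<open>x ^ r / N\<close> into
    \<open>2 * x ^ (r - 1)\<close>.\<close>
  then have "x \<le> 2 * real N"
    unfolding N_def by linarith
  have kr: "k * r \<ge> 2"
    using mult_le_mono[OF assms(2,1)] by simp
  have xr: "x ^ r = x * x ^ (r - 1)"
    using assms by (cases r) auto
  have err: "(\<Sum>b=1..N. (x / real (b ^ k)) ^ r - real (N div b ^ k) ^ r)
      \<in> {0..\<Sum>b=1..N. real r * (x / real (b ^ k)) ^ (r - 1)}"
    using floor_power_error[of x "_ ^ k" r] assms
    by (auto simp del: of_nat_power simp: N_def intro!: sum_nonneg sum_mono)
  have main: "(\<Sum>b=1..N. (x / real (b ^ k)) ^ r) = x ^ r * ?A"
    by (simp add: power_divide sum_distrib_left power_mult)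
  have bound: "(\<Sum>b=1..N. real r * (x / real (b ^ k)) ^ (r - 1))
      = x ^ (r - 1) * (real r * (\<Sum>b=1..N. 1 / real b ^ (k * (r - 1))))"
    by (simp add: power_divide sum_distrib_left power_mult mult_ac)
  have tail: "(zeta (real (k * r)) - ?A) \<in> {0..1 / real N}"
    by (rule zeta_split[OF \<open>N > 0\<close> kr])
  then have "x ^ r * (zeta (real (k * r)) - ?A) \<ge> 0"
    using assms by auto
  moreover have "x ^ r * (zeta (real (k * r)) - ?A) \<le> x ^ r * (1 / real N)"
    using tail assms by (intro mult_left_mono) auto
  moreover have "x ^ r * (1 / real N) \<le> x ^ (r - 1) * 2"
    using \<open>N > 0\<close> \<open>x \<le> 2 * real N\<close> assms by (simp add: xr field_simps)
  ultimately show ?thesis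
    using err unfolding sum_subtractf main bound by (simp add: algebra_simps)
qed

theorem theorem6:
  fixes r k :: nat
  assumes "r \<ge> 2" and "k \<ge> 1"
  shows "(\<lambda>x::real.
            (\<Sum>n \<in> {..<r} \<rightarrow>\<^sub>E {m::nat. 1 \<le> m \<and> real m \<le> x}. real (tau k (GCD i\<in>{..<r}. n i)))
              - zeta (real (k * r)) * x ^ r)
         \<in> O[at_top](R r k)"
proof (rule bigoI)
  \<comment> \<open>The first 2 comes from the zeta tail, the second from \<open>H <= 2\<close>. In
    the logarithmic case the constant is 6, and \<open>2 + 2 * (1 + ln x) <= 6 * ln x\<close> once
    \<open>ln x >= 1\<close>.\<close>
  let ?C = "2 + real r * 2"
  show "\<forall>\<^sub>F x in at_top. norm ((\<Sum>n \<in> {..<r} \<rightarrow>\<^sub>E {m::nat. 1 \<le> m \<and> real m \<le> x}.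
            real (tau k (GCD i\<in>{..<r}. n i))) - zeta (real (k * r)) * x ^ r) \<le> ?C * norm (R r k x)"
    \<comment> \<open>From \<open>exp 1\<close> on, \<open>ln x >= 1\<close>, so additive constants
      are absorbed into the logarithm.\<close>
    using eventually_ge_at_top[of "exp 1"]
  proof eventually_elim
    case (elim x)
    define N where "N = nat \<lfloor>x\<rfloor>"
    define H where "H = (\<Sum>b=1..N. 1 / real b ^ (k * (r - 1)))"
    have "x \<ge> 1"
      using elim exp_ge_add_one_self[of 1] by linarith
    then have "N > 0"
      by (auto simp: N_def)
    have ln: "ln x \<ge> 1"
      using elim \<open>x \<ge> 1\<close> by (simp add: ln_ge_iff)
    have "{m::nat. 1 \<le> m \<and> real m \<le> x} = {1..N}"
      using \<open>x \<ge> 1\<close> by (auto simp: N_def le_nat_floor le_nat_iff le_floor_iff)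
    then have "(\<Sum>n \<in> {..<r} \<rightarrow>\<^sub>E {m::nat. 1 \<le> m \<and> real m \<le> x}. real (tau k (GCD i\<in>{..<r}. n i)))
        = (\<Sum>b=1..N. real (N div b ^ k) ^ r)"
      using sum_tau_Gcd[of r k N] assms by (simp flip: of_nat_sum of_nat_power)
    moreover have "\<bar>(\<Sum>b=1..N. real (N div b ^ k) ^ r) - zeta (real (k * r)) * x ^ r\<bar>
        \<le> x ^ (r - 1) * (2 + real r * H)"
      unfolding N_def H_def by (rule sum_floor_power_error[OF assms \<open>x \<ge> 1\<close>])
    moreover have "x ^ (r - 1) * (2 + real r * H) \<le> ?C * \<bar>R r k x\<bar>"
    proof (cases "r * k > 2")
      case True
      \<comment> \<open>For \<open>r = 2\<close> the exponent is \<open>k\<close>, and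
        \<open>2 * k > 2\<close>; otherwise already \<open>r - 1 >= 2\<close>.\<close>
      have "k * (r - 1) \<ge> 2"
      proof (cases "r = 2")
        case False
        with assms mult_le_mono[of 1 k 2 "r - 1"] show ?thesis
          by simp
      qed (use True in simp)
      then have "H \<le> 2"
        unfolding H_def using \<open>N > 0\<close> by (rule sum_inverse_power_le[rotated])
      then have "x ^ (r - 1) * (2 + real r * H) \<le> x ^ (r - 1) * ?C"
        using \<open>x \<ge> 1\<close> by (intro mult_left_mono add_mono) auto
      then show ?thesis
        using True \<open>x \<ge> 1\<close> by (simp add: R_def mult.commute)
    next
      case False
      have "r * k \<ge> r" "r * k \<ge> 2 * k"
        using assms by auto
      with False assms have rk: "r = 2" "k = 1"
        by linarith+
      have "H \<le> 1 + ln x"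
        using sum_inverse_le_ln[OF \<open>x \<ge> 1\<close>] by (simp add: H_def N_def rk)
      then have "2 + real r * H \<le> ?C * ln x"
        using ln by (simp add: rk)
      then have "x * (2 + real r * H) \<le> x * (?C * ln x)"
        using \<open>x \<ge> 1\<close> by (intro mult_left_mono) auto
      then show ?thesis
        using \<open>x \<ge> 1\<close> ln by (simp add: R_def rk mult_ac abs_mult)
    qed
    ultimately show ?case
      by simp
  qed
qed

end
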